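(* Let $\#(n)$ be the number of different blocks of length $n$ allowed in the golden mean shift. Let $(F_n)_{n\ge 0}$ be the Fibonacci numbers with initial conditions $F_0=1$, $F_1=2$ and $F_n=F_{n-1}+F_{n-2}$ for $n\ge 2$. Then $\#(n)=F_n$ for every integer $n\ge 1$.
   Context: For a finite alphabet $\mathcal{A}$, the full shift $\mathcal{A}^{\mathbb{Z}}$ is the set of all bi-infinite sequences $(x_i)_{i\in\mathbb{Z}}$ with $x_i\in\mathcal{A}$. A block of length $n$ is a finite sequence of $n$ consecutive symbols. Given a set $\mathcal{F}$ of forbidden blocks, the associated shift space $X$ is the set of all bi-infinite sequences containing no block of $\mathcal{F}$. An allowed block of length $n$ is one that occurs in some sequence of $X$. The golden mean shift is the shift space over $\mathcal{A}=\{0,1\}$ with $\mathcal{F}=\{11\}$. *)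

theory Defs
  imports Main
begin

definition full_shift :: "'a set \<Rightarrow> (int \<Rightarrow> 'a) set" where
  "full_shift A = {x. \<forall>i. x i \<in> A}"

definition block_at :: "(int \<Rightarrow> 'a) \<Rightarrow> int \<Rightarrow> nat \<Rightarrow> 'a list" where
  "block_at x i n = map (\<lambda>k. x (i + int k)) [0..<n]"

definition occurs_in :: "'a list \<Rightarrow> (int \<Rightarrow> 'a) \<Rightarrow> bool" where
  "occurs_in w x \<longleftrightarrow> (\<exists>i. block_at x i (length w) = w)"

definition shift_space :: "'a set \<Rightarrow> 'a list set \<Rightarrow> (int \<Rightarrow> 'a) set" where
  "shift_space A W = {x \<in> full_shift A. \<forall>w\<in>W. \<not> occurs_in w x}"

(* A block is allowed only if it occurs in a bi-infinite point of X; merely avoiding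
   the forbidden blocks is in general a weaker condition. *)
definition allowed_blocks :: "(int \<Rightarrow> 'a) set \<Rightarrow> nat \<Rightarrow> 'a list set" where
  "allowed_blocks X n = {w. length w = n \<and> (\<exists>x\<in>X. occurs_in w x)}"

definition golden_mean_shift :: "(int \<Rightarrow> nat) set" where
  "golden_mean_shift = shift_space {0, 1} {[1, 1]}"

end

theory Submission
  imports Defs
begin

text \<open>A word over 0, 1 without two consecutive ones extends to a point of the shift by padding it
  with zeros on both sides, so the allowed blocks are exactly these words. Splitting them
  into 0w and 10w gives the Fibonacci recursion.\<close>

definition golden_words :: "nat \<Rightarrow> nat list set" where
  "golden_words n =
     {w. length w = n \<and> set w \<subseteq> {0, 1} \<and> successively (\<lambda>a b. a = 0 \<or> b = 0) w}"

text \<open>Over the symbols 0 and 1, "not both 1" becomes "one of the two is 0". This local form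
  matches the adjacency predicate in \<open>golden_words\<close>, so points and words can be
  compared position by position.\<close>

lemma golden_mean_shift_iff:
  "x \<in> golden_mean_shift \<longleftrightarrow> (\<forall>i. x i \<in> {0, 1}) \<and> (\<forall>i. x i = 0 \<or> x (i + 1) = 0)"
proof -
  have "occurs_in [1, 1] x \<longleftrightarrow> (\<exists>i. x i = 1 \<and> x (i + 1) = 1)"
    by (simp add: occurs_in_def block_at_def)
  then have "x \<in> golden_mean_shift \<longleftrightarrow> (\<forall>i. x i \<in> {0, 1}) \<and> (\<forall>i. \<not> (x i = 1 \<and> x (i + 1) = 1))"
    by (simp add: golden_mean_shift_def shift_space_def full_shift_def)
  also have "\<dots> \<longleftrightarrow> (\<forall>i. x i \<in> {0, 1}) \<and> (\<forall>i. x i = 0 \<or> x (i + 1) = 0)"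
    by (metis empty_iff insert_iff zero_neq_one)
  finally show ?thesis .
qed

lemma block_at_golden_words:
  assumes "x \<in> golden_mean_shift"
  shows "block_at x i n \<in> golden_words n"
proof -
  have "x (i + int k) = 0 \<or> x (i + int (Suc k)) = 0" for k
    using assms[unfolded golden_mean_shift_iff, THEN conjunct2, THEN spec, of "i + int k"]
    by (simp add: algebra_simps)
  then have "successively (\<lambda>a b. a = 0 \<or> b = 0) (block_at x i n)"
    by (simp add: block_at_def successively_conv_nth)
  moreover have "set (block_at x i n) \<subseteq> {0, 1}" "length (block_at x i n) = n"
    using assms unfolding block_at_def golden_mean_shift_iff by (simp_all add: image_subset_iff)
  ultimately show ?thesis
    by (simp add: golden_words_def)
qed

lemma golden_words_extend:
  assumes "w \<in> golden_words n"
  obtains x where "x \<in> golden_mean_shift" "occurs_in w x"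
proof
  define x where "x i = (if 0 \<le> i \<and> i < int n then w ! nat i else 0)" for i :: int
  have len: "length w = n" and alph: "set w \<subseteq> {0, 1}"
    and succ: "\<And>k. Suc k < n \<Longrightarrow> w ! k = 0 \<or> w ! Suc k = 0"
    using assms by (auto simp: golden_words_def successively_conv_nth)
  have "x i \<in> {0, 1}" for i
    using subsetD[OF alph nth_mem[of "nat i" w]] len by (auto simp: x_def)
  \<comment> \<open>If \<open>i\<close> and \<open>i + 1\<close> both lie in the window from 0 to
    \<open>n - 1\<close>, then \<open>succ\<close> applies; otherwise one of them lies outside,
    where \<open>x\<close> is 0. So no 11 arises at the seams.\<close>
  moreover have "x i = 0 \<or> x (i + 1) = 0" for i
    using succ[of "nat i"] by (auto simp: x_def nat_add_distrib)
  ultimately show "x \<in> golden_mean_shift"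
    by (simp add: golden_mean_shift_iff)
  have "block_at x 0 (length w) = w"
    by (rule nth_equalityI) (simp_all add: block_at_def x_def len)
  then show "occurs_in w x"
    unfolding occurs_in_def ..
qed

lemma allowed_blocks_golden_mean_shift:
  "allowed_blocks golden_mean_shift n = golden_words n"
proof
  show "allowed_blocks golden_mean_shift n \<subseteq> golden_words n"
    unfolding allowed_blocks_def occurs_in_def by (auto dest: block_at_golden_words) (metis block_at_golden_words)
  show "golden_words n \<subseteq> allowed_blocks golden_mean_shift n"
    using golden_words_extend by (fastforce simp: allowed_blocks_def golden_words_def)
qed

lemma finite_golden_words: "finite (golden_words n)"
  by (rule finite_subset[OF _ finite_lists_length_eq[of "{0, 1}" n]])
    (auto simp: golden_words_def)

lemma golden_words_0: "golden_words 0 = {[]}"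
  by (auto simp: golden_words_def)

lemma golden_words_1: "golden_words (Suc 0) = {[0], [1]}"
  by (auto simp: golden_words_def length_Suc_conv)

text \<open>A leading 0 puts no condition on the next letter. A leading 1 forces a 0 after it, and
  this 0 leaves the rest free. The word [1] has no second letter, so the splitting starts at length
  two.\<close>

lemma golden_words_Suc_Suc:
  "golden_words (Suc (Suc n)) =
     (#) 0 ` golden_words (Suc n) \<union> (\<lambda>w. 1 # 0 # w) ` golden_words n"
proof -
  have zero: "0 # w \<in> golden_words (Suc k) \<longleftrightarrow> w \<in> golden_words k" for w k
    \<comment> \<open>The case split shows whether the leading 0 has a successor in
      \<open>w\<close>, so that \<open>successively\<close> can unfold.\<close>
    by (cases w) (auto simp: golden_words_def)
  have one: "1 # b # w \<in> golden_words (Suc (Suc k)) \<longleftrightarrow> b = 0 \<and> w \<in> golden_words k" for b w k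
    by (cases w) (auto simp: golden_words_def)
  have "w \<in> (#) 0 ` golden_words (Suc n) \<union> (\<lambda>w. 1 # 0 # w) ` golden_words n"
    if w: "w \<in> golden_words (Suc (Suc n))" for w
  proof -
    obtain a b v where "w = a # b # v" "a = 0 \<or> a = 1"
      using w by (auto simp: golden_words_def length_Suc_conv)
    then show ?thesis
      using w zero one by blast
  qed
  then show ?thesis
    using zero one by blast
qed

lemma card_golden_words_Suc_Suc:
  "card (golden_words (Suc (Suc n))) = card (golden_words (Suc n)) + card (golden_words n)"
proof -
  have "card ((#) 0 ` golden_words (Suc n)) = card (golden_words (Suc n))"
    "card ((\<lambda>w. 1 # 0 # w) ` golden_words n) = card (golden_words n)"
    by (simp_all add: card_image inj_on_def)
  then show ?thesis
    unfolding golden_words_Suc_Suc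
    \<comment> \<open>The two images are disjoint because their words differ in the first
      letter.\<close>
    by (subst card_Un_disjoint) (auto simp: finite_golden_words)
qed

theorem lemma1:
  fixes F :: "nat \<Rightarrow> nat" and n :: nat
  assumes "F 0 = 1" and "F 1 = 2"
    and "\<And>m. m \<ge> 2 \<Longrightarrow> F m = F (m - 1) + F (m - 2)"
    and "n \<ge> 1"
  shows "card (allowed_blocks golden_mean_shift n) = F n"
proof -
  \<comment> \<open>Including \<open>k = 0\<close>, where the empty word gives
    \<open>F 0 = 1\<close>, lets the two-step induction start from the two given initial
    values.\<close>
  have "card (golden_words k) = F k" for k
  proof (induction k rule: induct_nat_012)
    case 0
    show ?case
      using assms(1) by (simp add: golden_words_0)
  next
    case 1
    show ?case
      using assms(2) by (simp add: golden_words_1)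
  next
    case (ge2 k)
    then show ?case
      using assms(3)[of "Suc (Suc k)"] by (simp add: card_golden_words_Suc_Suc)
  qed
  then show ?thesis
    by (simp add: allowed_blocks_golden_mean_shift)
qed

end
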